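(* Consider a cache-oblivious algorithm with IO-complexity $C(M,B,n)$, where $M$ is the size of the cache, $B$ is the size of a block, and $n$ is the input size. Let $a:=\lfloor W/d\rfloor$, where $W$ is the size of the translation cache and $d$ is the depth of the translation tree, and let $P=2^p$ be the size of a page. Then the number of cache faults in the VAT model (with translation tree of arity $K$) is at most $$\sum_{i=0}^{d} C(aK^iP,\;K^iP,\;n).$$
   Context: IO-complexity (external memory model): a cache-oblivious algorithm is a RAM algorithm whose code does not refer to the parameters of the memory hierarchy. Memory is divided into blocks of $B$ consecutive cells; the cache has size $M$ and hence holds $M/B$ blocks ($B\le M$); only data in the cache can be accessed. A transfer of a block between cache and main memory is an IO-operation, and $C(M,B,n)$ is the number of IO-operations of the algorithm on an input of size $n$. VAT (virtual address translation) model: fix integers $K\ge2$, $d\ge1$, and a page size $P=2^p$. The translation tree is the $K$-ary tree of height $d$ with nodes $(\ell,i)$, $0\le\ell\le d$, $0\le i<K^{d-\ell}$; node $(\ell,i)$ with $\ell\ge 1$ has children $(\ell-1,Ki+b)$, $b=0,\dots,K-1$; the root is $(d,0)$; the leaves, on layer $0$, are the data pages. A virtual address is an integer $\alpha\in[0,K^dP-1]$ (all addresses used by the algorithm lie in this range); its translation path is $v_d,\dots,v_0$ with $v_\ell=(\ell,\lfloor\alpha/(PK^\ell)\rfloor)$. The translation cache (TC) stores at most $W$ nodes of the translation tree, where $d\le W$. Each memory access to address $\alpha$ requires accessing $v_d,\dots,v_0$ in this order, and a node can be accessed only while it is in the TC. The number of cache faults is the number of insertions of nodes into the TC over the whole execution.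 The translation process is assumed to make optimal use of the translation cache.
   Formalization: When d divides W and a ≤ K, the formal theorem allows the translation cache W+1 nodes instead of W; with W nodes the claim fails there (cyclically visiting a pages below distinct children of the root faults every round). In all other cases the size is exactly W. *)

theory Defs
  imports Main "HOL-Library.Extended_Nat"
begin

section \<open>Algorithms\<close>

datatype access = Read nat | Write nat

fun address :: "access \<Rightarrow> nat" where
  "address (Read \<alpha>) = \<alpha>"
| "address (Write \<alpha>) = \<alpha>"

text \<open>
  Both cost measures depend on an algorithm only through the sequence of memory accesses it makes
  on each input. Cache-obliviousness is built in: this sequence is a function of the input alone,
  not of \<open>M\<close>, \<open>B\<close>, \<open>K\<close>, \<open>d\<close>, \<open>W\<close> or \<open>p\<close>.
\<close>

record 'x algorithm =
  input_size :: "'x \<Rightarrow> nat"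
  accesses :: "'x \<Rightarrow> access list"


section \<open>The external memory model\<close>

text \<open>
  \<open>em_run M B as S D k\<close>: a machine whose cache holds the blocks \<open>S\<close>, of which those in \<open>D\<close> differ
  from their copy in main memory, can perform the accesses \<open>as\<close> with exactly \<open>k\<close> block transfers.
  Block \<open>b\<close> consists of the cells \<open>b * B, \<dots>, b * B + B - 1\<close>. A modified block has to be transferred
  back before it can leave the cache.
\<close>

inductive em_run :: "nat \<Rightarrow> nat \<Rightarrow> access list \<Rightarrow> nat set \<Rightarrow> nat set \<Rightarrow> nat \<Rightarrow> bool"
  for M B :: nat where
  finish: "em_run M B [] S D 0"
| fetch: "b \<notin> S \<Longrightarrow> card (insert b S) \<le> M div B \<Longrightarrow> em_run M B as (insert b S) D k
    \<Longrightarrow> em_run M B as S D (Suc k)"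
| write_back: "b \<in> D \<Longrightarrow> em_run M B as S (D - {b}) k \<Longrightarrow> em_run M B as S D (Suc k)"
| evict: "b \<in> S \<Longrightarrow> b \<notin> D \<Longrightarrow> em_run M B as (S - {b}) D k \<Longrightarrow> em_run M B as S D k"
| read_cell: "\<alpha> div B \<in> S \<Longrightarrow> em_run M B as S D k \<Longrightarrow> em_run M B (Read \<alpha> # as) S D k"
| write_cell: "\<alpha> div B \<in> S \<Longrightarrow> em_run M B as S (insert (\<alpha> div B) D) k
    \<Longrightarrow> em_run M B (Write \<alpha> # as) S D k"

text \<open>
  Block transfers are scheduled optimally, starting from an empty cache; an infimum over no run at
  all is \<open>\<infinity>\<close>. Any other replacement strategy only increases \<open>io_complexity\<close>.
\<close>

definition io_count :: "nat \<Rightarrow> nat \<Rightarrow> access list \<Rightarrow> enat" where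
  "io_count M B as = Inf {enat k | k. em_run M B as {} {} k}"

definition io_complexity :: "'x algorithm \<Rightarrow> nat \<Rightarrow> nat \<Rightarrow> nat \<Rightarrow> enat" where
  "io_complexity A M B n = (SUP x \<in> {x. input_size A x = n}. io_count M B (accesses A x))"


section \<open>Virtual address translation\<close>

type_synonym node = "nat \<times> nat"

definition tree_nodes :: "nat \<Rightarrow> nat \<Rightarrow> node set" where
  "tree_nodes K d = {(l, i). l \<le> d \<and> i < K ^ (d - l)}"

definition translation_path :: "nat \<Rightarrow> nat \<Rightarrow> nat \<Rightarrow> nat \<Rightarrow> node list" where
  "translation_path K d P \<alpha> = map (\<lambda>l. (l, \<alpha> div (P * K ^ l))) (rev [0..<Suc d])"

text \<open>
  \<open>tc_run K d W vs S k\<close>: starting with the set \<open>S\<close> of nodes in a translation cache of size \<open>W\<close>, the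
  nodes \<open>vs\<close> can be accessed in this order with exactly \<open>k\<close> insertions.
\<close>

inductive tc_run :: "nat \<Rightarrow> nat \<Rightarrow> nat \<Rightarrow> node list \<Rightarrow> node set \<Rightarrow> nat \<Rightarrow> bool"
  for K d W :: nat where
  finish: "tc_run K d W [] S 0"
| insertion: "v \<in> tree_nodes K d \<Longrightarrow> v \<notin> S \<Longrightarrow> card (insert v S) \<le> W
    \<Longrightarrow> tc_run K d W vs (insert v S) k \<Longrightarrow> tc_run K d W vs S (Suc k)"
| eviction: "v \<in> S \<Longrightarrow> tc_run K d W vs (S - {v}) k \<Longrightarrow> tc_run K d W vs S k"
| node_access: "v \<in> S \<Longrightarrow> tc_run K d W vs S k \<Longrightarrow> tc_run K d W (v # vs) S k"

definition fault_count :: "nat \<Rightarrow> nat \<Rightarrow> nat \<Rightarrow> nat \<Rightarrow> access list \<Rightarrow> enat" where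
  "fault_count K d P W as =
     Inf {enat k | k. tc_run K d W (concat (map (translation_path K d P \<circ> address) as)) {} k}"

definition vat_faults :: "'x algorithm \<Rightarrow> nat \<Rightarrow> nat \<Rightarrow> nat \<Rightarrow> nat \<Rightarrow> nat \<Rightarrow> enat" where
  "vat_faults A K d P W n =
     (SUP x \<in> {x. input_size A x = n}. fault_count K d P W (accesses A x))"

text \<open>
  A translation path has \<open>d + 1\<close> nodes, so keeping \<open>a = W div d\<close> nodes of each layer below the root
  together with the root takes \<open>d * a + 1\<close> slots, unless some layer has fewer than \<open>a\<close> nodes. If
  \<open>d dvd W\<close> and \<open>a \<le> K\<close>, then \<open>W\<close> slots are one too few, and the bound
  \<open>\<Sum>i\<le>d. io_complexity A (a * K ^ i * P) (K ^ i * P) n\<close> on the faults fails: visit, cyclically and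
  often, \<open>a\<close> pages below distinct children of the root. These are \<open>d * a + 1 = W + 1\<close> nodes, so every
  round faults, whereas the bound stays \<open>d * a + 1\<close>. In exactly this case, \<open>tc_size\<close> has an
  additional slot (for the root).
\<close>

definition tc_size :: "nat \<Rightarrow> nat \<Rightarrow> nat \<Rightarrow> nat" where
  "tc_size K d W = (if d dvd W \<and> W div d \<le> K then W + 1 else W)"

end

theory Submission
  imports Defs
begin

text \<open>
  The nodes of layer \<open>i\<close> on a translation path are the blocks of size \<open>K\<^sup>i P\<close> containing the address.
  So the translation cache can be split into one part per layer, the part of layer \<open>i\<close> following an
  optimal external memory run with block size \<open>K\<^sup>i P\<close> and room for \<open>a\<close> blocks. A part never needs
  more slots than its layer has nodes; this saves enough in the top layers (the root alone needs one
  slot) for all parts to fit.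
\<close>

section \<open>Cutting external memory runs at their accesses\<close>

text \<open>What a run does to the cache between two accesses, with dirty blocks forgotten. Only
  loads cost: a write-back has no counterpart in the translation cache.\<close>

inductive moves :: "nat \<Rightarrow> 'b set \<Rightarrow> 'b set \<Rightarrow> nat \<Rightarrow> bool" for m :: nat where
  stay: "moves m S S 0"
| load: "b \<notin> S \<Longrightarrow> card (insert b S) \<le> m \<Longrightarrow> moves m (insert b S) S' k \<Longrightarrow> moves m S S' (Suc k)"
| drop: "b \<in> S \<Longrightarrow> moves m (S - {b}) S' k \<Longrightarrow> moves m S S' k"

lemma moves_bounded:
  assumes "moves m S S' k" "finite S" "card S \<le> m"
  shows "finite S' \<and> card S' \<le> m"
  using assms
proof (induction rule: moves.induct)
  case (drop b S S' k)
  then show ?case by (meson card_Diff1_le finite_Diff order_trans)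
qed auto

text \<open>Everything before the first access becomes \<open>moves\<close>, the rest stays a run.
  Dropping the write-backs can make \<open>k1 + k2\<close> smaller than \<open>k\<close>.\<close>

lemma em_run_step:
  assumes "em_run M B (x # as) S D k"
  shows "\<exists>S' D' k1 k2. moves (M div B) S S' k1 \<and> address x div B \<in> S'
    \<and> em_run M B as S' D' k2 \<and> k1 + k2 \<le> k"
  using assms
proof (induction "x # as" S D k rule: em_run.induct)
  case (fetch b S D k)
  then obtain S' D' k1 k2 where "moves (M div B) (insert b S) S' k1" "address x div B \<in> S'"
    "em_run M B as S' D' k2" "k1 + k2 \<le> k" by blast
  moreover from this fetch have "moves (M div B) S S' (Suc k1)" by (auto intro: moves.load)
  ultimately show ?case by (metis add_Suc Suc_le_mono)
next
  case (write_back b D S k)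
  then show ?case by (meson le_SucI)
next
  case (evict b S D k)
  then show ?case by (meson moves.drop)
next
  case (read_cell \<alpha> S D k)
  then show ?case by (metis address.simps(1) moves.stay add_0 order_refl)
next
  case (write_cell \<alpha> S D k)
  then show ?case by (metis address.simps(2) moves.stay add_0 order_refl)
qed

section \<open>Simulation by the translation cache\<close>

text \<open>The parts of all layers together. The intersection is there because an external memory
  run may fetch blocks beyond the address range; these are not nodes of the tree and are not
  mirrored.\<close>

definition contents :: "nat \<Rightarrow> nat \<Rightarrow> (nat \<Rightarrow> nat set) \<Rightarrow> node set" where
  "contents K d C = (SIGMA l:{..d}. C l \<inter> {..<K ^ (d - l)})"

lemma contents_empty: "contents K d (\<lambda>_. {}) = {}"
  by (simp add: contents_def)

lemma card_contents_le:
  assumes "\<And>l. l \<le> d \<Longrightarrow> finite (C l) \<and> card (C l) \<le> m"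
  shows "card (contents K d C) \<le> (\<Sum>l\<le>d. min m (K ^ (d - l)))"
proof -
  have "card (C l \<inter> {..<K ^ (d - l)}) \<le> min m (K ^ (d - l))" if "l \<le> d" for l
  proof -
    have "card (C l \<inter> {..<K ^ (d - l)}) \<le> card (C l)"
      using assms[OF that] by (intro card_mono) auto
    moreover have "card (C l \<inter> {..<K ^ (d - l)}) \<le> card {..<K ^ (d - l)}"
      by (intro card_mono) auto
    ultimately show ?thesis using assms[OF that] by simp
  qed
  then show ?thesis
    unfolding contents_def by (subst card_SigmaI) (auto intro: sum_mono)
qed

lemma contents_insert:
  "l \<le> d \<Longrightarrow> b < K ^ (d - l) \<Longrightarrow>
    contents K d (C(l := insert b S)) = insert (l, b) (contents K d (C(l := S)))"
  by (auto simp: contents_def split: if_splits)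

lemma contents_insert_outside:
  "\<not> b < K ^ (d - l) \<Longrightarrow> contents K d (C(l := insert b S)) = contents K d (C(l := S))"
  by (auto simp: contents_def split: if_splits)

lemma contents_remove:
  "contents K d (C(l := S - {b})) = contents K d (C(l := S)) - {(l, b)}"
  by (auto simp: contents_def split: if_splits)

text \<open>Runs are built from the back: moves of layer \<open>l\<close> are put in front of a
  given run while all other layers stand still. A load costs one insertion, or none if its block is
  no tree node. The slots suffice by \<open>card_contents_le\<close>, as the guard of
  \<open>load\<close> bounds layer \<open>l\<close>.\<close>

lemma tc_run_moves:
  assumes "moves m S S' k" and "finite S"
    and "l \<le> d" and size: "(\<Sum>l\<le>d. min m (K ^ (d - l))) \<le> W"
    and C: "\<And>l. l \<le> d \<Longrightarrow> finite (C l) \<and> card (C l) \<le> m"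
    and "tc_run K d W vs (contents K d (C(l := S'))) j"
  shows "\<exists>j' \<le> k + j. tc_run K d W vs (contents K d (C(l := S))) j'"
  using assms(1,2,6)
proof (induction rule: moves.induct)
  case (stay S)
  then show ?case by auto
next
  case (load b S S' k)
  then obtain j' where j': "j' \<le> k + j" "tc_run K d W vs (contents K d (C(l := insert b S))) j'"
    using finite_insert by metis
  show ?case
  proof (cases "b < K ^ (d - l)")
    case True
    have "card (contents K d (C(l := insert b S))) \<le> W"
      by (rule order_trans[OF card_contents_le size]) (use C load in auto)
    moreover have "(l, b) \<in> tree_nodes K d" "(l, b) \<notin> contents K d (C(l := S))"
      using True \<open>l \<le> d\<close> load by (auto simp: tree_nodes_def contents_def)
    ultimately have "tc_run K d W vs (contents K d (C(l := S))) (Suc j')"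
      using j'(2) contents_insert[OF \<open>l \<le> d\<close> True] by (metis tc_run.insertion)
    then show ?thesis using j'(1) by (metis add_Suc Suc_le_mono)
  next
    case False
    then show ?thesis using j' contents_insert_outside[OF False] by (metis add_Suc le_SucI)
  qed
next
  case (drop b S S' k)
  then obtain j' where j': "j' \<le> k + j"
    "tc_run K d W vs (contents K d (C(l := S)) - {(l, b)}) j'"
    unfolding contents_remove by auto
  \<comment> \<open>If \<open>b\<close> lies outside the layer, removing \<open>(l, b)\<close>
    changes nothing and there is nothing to evict.\<close>
  then show ?case
    by (metis Diff_empty Diff_insert0 tc_run.eviction)
qed

text \<open>Serves one translation path: each layer is rearranged just before its own node is
  accessed. As \<open>ls\<close> has no repetitions, a rearranged layer stays at \<open>C' l\<close>
  while the others follow, so the induction varies the initial family \<open>C\<close>.\<close>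

lemma tc_run_layers:
  assumes "distinct ls" and "set ls \<subseteq> {..d}"
    and "(\<Sum>l\<le>d. min m (K ^ (d - l))) \<le> W"
    and "\<And>l. l \<le> d \<Longrightarrow> finite (C l) \<and> card (C l) \<le> m"
    and "\<And>l. l \<in> set ls \<Longrightarrow> moves m (C l) (C' l) (k l) \<and> b l \<in> C' l \<and> b l < K ^ (d - l)"
    and "\<And>l. l \<notin> set ls \<Longrightarrow> C' l = C l"
    and "tc_run K d W vs (contents K d C') j"
  shows "\<exists>j' \<le> (\<Sum>l\<in>set ls. k l) + j.
    tc_run K d W (map (\<lambda>l. (l, b l)) ls @ vs) (contents K d C) j'"
  using assms(1,2,4-)
proof (induction ls arbitrary: C)
  case Nil
  then have "C' = C" by auto
  with Nil show ?case by auto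
next
  case (Cons l ls)
  have l: "l \<le> d" "moves m (C l) (C' l) (k l)" "b l \<in> C' l" "b l < K ^ (d - l)" "l \<notin> set ls"
    using Cons.prems by auto
  let ?C = "C(l := C' l)"
  have bounded: "finite (?C i) \<and> card (?C i) \<le> m" if "i \<le> d" for i
    using moves_bounded[OF l(2)] Cons.prems(3) l(1) that by auto
  have "\<exists>j' \<le> (\<Sum>l\<in>set ls. k l) + j.
      tc_run K d W (map (\<lambda>l. (l, b l)) ls @ vs) (contents K d ?C) j'"
    by (rule Cons.IH) (use Cons.prems bounded l in auto)
  then obtain j1 where j1: "j1 \<le> (\<Sum>l\<in>set ls. k l) + j"
    "tc_run K d W (map (\<lambda>l. (l, b l)) ls @ vs) (contents K d ?C) j1" by blast
  have "(l, b l) \<in> contents K d ?C" using l by (auto simp: contents_def)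
  with j1(2) have "tc_run K d W (map (\<lambda>l. (l, b l)) (l # ls) @ vs) (contents K d ?C) j1"
    by (auto intro: tc_run.node_access)
  from tc_run_moves[OF l(2) _ l(1) assms(3) Cons.prems(3) this]
  obtain j2 where "j2 \<le> k l + j1"
    "tc_run K d W (map (\<lambda>l. (l, b l)) (l # ls) @ vs) (contents K d (C(l := C l))) j2"
    using Cons.prems(3)[OF l(1)] by blast
  then show ?case using j1(1) l(5) by (intro exI[of _ j2]) auto
qed

text \<open>All layers process the same access list, each by its own run at its own cost. Cutting
  every run at the first access yields the moves for one translation path; the remaining runs
  continue by induction.\<close>

lemma tc_run_accesses:
  assumes "K > 0" and "P > 0"
    and "(\<Sum>l\<le>d. min m (K ^ (d - l))) \<le> W"
    and "\<And>\<alpha>. \<alpha> \<in> address ` set as \<Longrightarrow> \<alpha> < K ^ d * P"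
    and "\<And>l. l \<le> d \<Longrightarrow> finite (C l) \<and> card (C l) \<le> m"
    and "\<And>l. l \<le> d \<Longrightarrow> em_run (m * K ^ l * P) (K ^ l * P) as (C l) (D l) (k l)"
  shows "\<exists>j \<le> (\<Sum>l\<le>d. k l).
    tc_run K d W (concat (map (translation_path K d P \<circ> address) as)) (contents K d C) j"
  using assms(4-)
proof (induction as arbitrary: C D k)
  case Nil
  then show ?case by (auto intro: tc_run.finish)
next
  case (Cons x as)
  \<comment> \<open>Every layer has room for the same number \<open>m\<close> of blocks, whatever
    its block size.\<close>
  have blocks: "m * K ^ l * P div (K ^ l * P) = m" for l
    using assms(1,2) by (simp add: mult.assoc)
  have "\<forall>l. \<exists>S' D' k1 k2. l \<le> d \<longrightarrow> moves m (C l) S' k1 \<and> address x div (K ^ l * P) \<in> S'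
    \<and> em_run (m * K ^ l * P) (K ^ l * P) as S' D' k2 \<and> k1 + k2 \<le> k l"
    using em_run_step[OF Cons.prems(3)] unfolding blocks by blast
  then obtain C1 D1 k1 k2 where step: "\<And>l. l \<le> d \<Longrightarrow> moves m (C l) (C1 l) (k1 l)
      \<and> address x div (K ^ l * P) \<in> C1 l
      \<and> em_run (m * K ^ l * P) (K ^ l * P) as (C1 l) (D1 l) (k2 l) \<and> k1 l + k2 l \<le> k l"
    by metis
  \<comment> \<open>Choice says nothing about \<open>C1\<close> beyond layer \<open>d\<close>,
    whereas \<open>tc_run_layers\<close> wants all layers off the path unchanged.\<close>
  define C' where "C' l = (if l \<le> d then C1 l else C l)" for l
  have "\<exists>j \<le> (\<Sum>l\<le>d. k2 l).
      tc_run K d W (concat (map (translation_path K d P \<circ> address) as)) (contents K d C') j"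
  proof (rule Cons.IH)
    show "finite (C' l) \<and> card (C' l) \<le> m" if "l \<le> d" for l
      using moves_bounded step[OF that] Cons.prems(2)[OF that] that by (auto simp: C'_def)
    show "em_run (m * K ^ l * P) (K ^ l * P) as (C' l) (D1 l) (k2 l)" if "l \<le> d" for l
      using step[OF that] that by (simp add: C'_def)
  qed (use Cons.prems(1) in auto)
  then obtain j where j: "j \<le> (\<Sum>l\<le>d. k2 l)"
    "tc_run K d W (concat (map (translation_path K d P \<circ> address) as)) (contents K d C') j"
    by blast
  \<comment> \<open>The address bound makes the accessed block a node of its layer, so
    \<open>contents\<close> does not cut it off.\<close>
  have node: "address x div (P * K ^ l) < K ^ (d - l)" if "l \<le> d" for l
  proof -
    have "K ^ d = K ^ (d - l) * K ^ l" using that by (simp flip: power_add)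
    then have "address x < K ^ (d - l) * (P * K ^ l)"
      using Cons.prems(1)[of "address x"] by (simp add: mult_ac)
    then show ?thesis by (simp add: less_mult_imp_div_less)
  qed
  have layers: "set (rev [0..<Suc d]) = {..d}" by auto
  have "\<exists>j' \<le> (\<Sum>l\<in>set (rev [0..<Suc d]). k1 l) + j.
      tc_run K d W (map (\<lambda>l. (l, address x div (P * K ^ l))) (rev [0..<Suc d])
        @ concat (map (translation_path K d P \<circ> address) as)) (contents K d C) j'"
  proof (rule tc_run_layers[OF _ _ assms(3) Cons.prems(2) _ _ j(2)])
    show "moves m (C l) (C' l) (k1 l) \<and> address x div (P * K ^ l) \<in> C' l
        \<and> address x div (P * K ^ l) < K ^ (d - l)" if "l \<in> set (rev [0..<Suc d])" for l
      using step[of l] node[of l] that unfolding layers by (simp add: C'_def mult.commute)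
  qed (unfold layers, auto simp: C'_def)
  then obtain j' where j': "j' \<le> (\<Sum>l\<le>d. k1 l) + j"
    "tc_run K d W (concat (map (translation_path K d P \<circ> address) (x # as))) (contents K d C) j'"
    unfolding layers by (auto simp only: translation_path_def list.map concat.simps o_apply)
  have "(\<Sum>l\<le>d. k1 l) + (\<Sum>l\<le>d. k2 l) \<le> (\<Sum>l\<le>d. k l)"
    unfolding sum.distrib[symmetric] using step by (intro sum_mono) auto
  with j(1) j'(1) have "j' \<le> (\<Sum>l\<le>d. k l)" by simp
  with j'(2) show ?case by blast
qed

section \<open>From runs to optimal costs\<close>

text \<open>The infimum of the empty set is infinite, so a finite one is attained by well-ordering.
  This turns an optimal cost into an actual run.\<close>

lemma Inf_enat_attained:
  assumes "Inf {enat k | k. Q k} = enat j"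
  shows "Q j"
proof -
  have "{enat k | k. Q k} \<noteq> {}"
    using assms by (force simp: Inf_enat_def)
  then have "Inf {enat k | k. Q k} \<in> {enat k | k. Q k}"
    by (metis (no_types, lifting) ex_in_conv wellorder_InfI)
  with assms show ?thesis by auto
qed

lemma fault_count_le:
  assumes "K > 0" and "P > 0"
    and "(\<Sum>l\<le>d. min m (K ^ (d - l))) \<le> W"
    and "\<And>\<alpha>. \<alpha> \<in> address ` set as \<Longrightarrow> \<alpha> < K ^ d * P"
  shows "fault_count K d P W as \<le> (\<Sum>l\<le>d. io_count (m * K ^ l * P) (K ^ l * P) as)"
proof (cases "\<exists>l\<le>d. io_count (m * K ^ l * P) (K ^ l * P) as = \<infinity>")
  \<comment> \<open>If some layer has no run, the right-hand side is infinite.\<close>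
  case True
  then obtain l where "l \<le> d" "io_count (m * K ^ l * P) (K ^ l * P) as = \<infinity>" by blast
  moreover from \<open>l \<le> d\<close> have "io_count (m * K ^ l * P) (K ^ l * P) as
      \<le> (\<Sum>l\<le>d. io_count (m * K ^ l * P) (K ^ l * P) as)"
    by (intro member_le_sum) auto
  ultimately show ?thesis by simp
next
  case False
  then have "\<forall>l. \<exists>k. l \<le> d \<longrightarrow> io_count (m * K ^ l * P) (K ^ l * P) as = enat k"
    by (metis not_infinity_eq)
  then obtain k where k: "\<And>l. l \<le> d \<Longrightarrow> io_count (m * K ^ l * P) (K ^ l * P) as = enat (k l)"
    by metis
  have "\<exists>j \<le> (\<Sum>l\<le>d. k l).
      tc_run K d W (concat (map (translation_path K d P \<circ> address) as)) (contents K d (\<lambda>_. {})) j"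
  proof (rule tc_run_accesses[OF assms])
    show "em_run (m * K ^ l * P) (K ^ l * P) as {} {} (k l)" if "l \<le> d" for l
      using k[OF that] unfolding io_count_def by (rule Inf_enat_attained)
  qed auto
  then obtain j where j: "j \<le> (\<Sum>l\<le>d. k l)"
    "tc_run K d W (concat (map (translation_path K d P \<circ> address) as)) {} j"
    by (auto simp: contents_empty)
  have "fault_count K d P W as \<le> enat j"
    unfolding fault_count_def using j(2) by (intro Inf_lower) auto
  also have "\<dots> \<le> enat (\<Sum>l\<le>d. k l)" using j(1) by simp
  also have "\<dots> = (\<Sum>l\<le>d. enat (k l))"
    by (induction d) (auto simp flip: plus_enat_simps)
  also have "\<dots> = (\<Sum>l\<le>d. io_count (m * K ^ l * P) (K ^ l * P) as)"
    by (intro sum.cong) (auto simp: k)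
  finally show ?thesis .
qed

text \<open>Let \<open>a = W div d\<close> and \<open>d = Suc e\<close>. The \<open>e\<close> lowest
  layers take at most \<open>a\<close> slots each, the children of the root \<open>min a K\<close>,
  the root one, against \<open>W = d * a + W mod d\<close>. The root's slot is paid by the remainder
  if \<open>d\<close> does not divide \<open>W\<close>, by the layer below the root if
  \<open>a > K\<close>, and otherwise by the extra slot in \<open>tc_size\<close>.\<close>

lemma sum_layers_le_tc_size:
  assumes "d \<ge> 1"
  shows "(\<Sum>l\<le>d. min (W div d) (K ^ (d - l))) \<le> tc_size K d W"
proof -
  let ?a = "W div d"
  obtain e where e: "d = Suc e" using assms by (cases d) auto
  have "(\<Sum>l<e. min ?a (K ^ (d - l))) \<le> (\<Sum>l<e. ?a)" by (intro sum_mono) auto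
  then have "(\<Sum>l\<le>d. min ?a (K ^ (d - l))) \<le> e * ?a + min ?a K + 1"
    by (simp add: e flip: lessThan_Suc_atMost)
  moreover have "W = e * ?a + ?a + W mod d"
    using div_mult_mod_eq[of W d] e by (simp add: algebra_simps)
  moreover have "W mod d > 0" if "\<not> d dvd W" using that by (simp add: dvd_eq_mod_eq_0)
  ultimately show ?thesis unfolding tc_size_def by (auto simp: min_def split: if_splits)
qed

theorem theorem7p1:
  fixes A :: "'x algorithm" and K d p P W a n :: nat
  assumes "P = 2 ^ p" and "a = W div d"
    and "K \<ge> 2" and "d \<ge> 1" and "d \<le> W"
    and "\<And>x \<alpha>. input_size A x = n \<Longrightarrow> \<alpha> \<in> address ` set (accesses A x) \<Longrightarrow> \<alpha> < K ^ d * P"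
  shows "vat_faults A K d P (tc_size K d W) n
    \<le> (\<Sum>i = 0..d. io_complexity A (a * K ^ i * P) (K ^ i * P) n)"
  unfolding vat_faults_def
proof (rule SUP_least)
  fix x
  assume x: "x \<in> {x. input_size A x = n}"
  have "fault_count K d P (tc_size K d W) (accesses A x)
      \<le> (\<Sum>i\<le>d. io_count (a * K ^ i * P) (K ^ i * P) (accesses A x))"
    by (rule fault_count_le) (use assms sum_layers_le_tc_size x in auto)
  \<comment> \<open>Each layer may take its supremum at a different input, which only enlarges the
    bound.\<close>
  also have "\<dots> \<le> (\<Sum>i\<le>d. io_complexity A (a * K ^ i * P) (K ^ i * P) n)"
    unfolding io_complexity_def using x by (intro sum_mono SUP_upper)
  finally show "fault_count K d P (tc_size K d W) (accesses A x)
      \<le> (\<Sum>i = 0..d. io_complexity A (a * K ^ i * P) (K ^ i * P) n)"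
    by (simp add: atMost_atLeast0)
qed

end
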